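(* Let $G$ be a finite bipartite graph with partition classes $X$ and $Y$, and let $k>0$. Let $\tau$ be a tangle of $\vec S_{16k}(X)$, let $\tau' = {}^{\triangleright}\tau \cap \vec S_{4k}(Y)$, and let $\tau'' = {}^{\triangleleft}\tau'\cap \vec S_k(X)$. Then $\tau'' \subseteq \tau$.
   Context: Let $G$ be a finite (simple) bipartite graph with partition classes $X$ and $Y$; $N(v)$ denotes the set of neighbours of a vertex $v$. Separations: for $Z\in\{X,Y\}$, $\vec S(Z)$ is the set of all oriented separations of $Z$, i.e. ordered pairs $(A,B)$ of subsets of $Z$ with $A\cup B=Z$ (the sets $A,B$ may intersect and may be empty). The inverse of $(A,B)$ is $(B,A)$. Order functions: for $(A,B)\in\vec S(X)$, $$|A,B|_X:=\sum_{y\in Y}\Big(\min\{|N(y)\cap A|,|N(y)\cap B|\}-\tfrac12|N(y)\cap A\cap B|\Big),$$ and for $(C,D)\in\vec S(Y)$, $|C,D|_Y$ is defined in the same way with the roles of $X$ and $Y$ exchanged. For a real number $k>0$, $\vec S_k(X)$ is the set of $(A,B)\in\vec S(X)$ with $|A,B|_X<k$; similarly $\vec S_k(Y)$. Standing assumption: whenever a set $\vec S_k(X)$ (resp. $\vec S_k(Y)$) is considered, $k$ is assumed to be such that $(X,X)\notin\vec S_k(X)$ (resp. $(Y,Y)\notin\vec S_k(Y)$). Shifts: for $(A,B)\in\vec S(X)$ let $(A,B)^\triangleright:=(A_B^\triangleright,B_A^\triangleright)\in\vec S(Y)$, where $A_B^\triangleright=\{y\in Y: |N(y)\cap A|\ge|N(y)\cap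 B|\}$ and $B_A^\triangleright=\{y\in Y: |N(y)\cap A|\le|N(y)\cap B|\}$. For $(C,D)\in\vec S(Y)$ let $(C,D)^\triangleleft:=(C_D^\triangleleft,D_C^\triangleleft)\in\vec S(X)$, where $C_D^\triangleleft=\{x\in X: |N(x)\cap C|\ge|N(x)\cap D|\}$ and $D_C^\triangleleft=\{x\in X: |N(x)\cap C|\le|N(x)\cap D|\}$. Pull-backs: for $\tau\subseteq\vec S(X)$, ${}^{\triangleright}\tau:=\{(C,D)\in\vec S(Y): (C,D)^\triangleleft\in\tau\}$; for $\tau\subseteq\vec S(Y)$, ${}^{\triangleleft}\tau:=\{(A,B)\in\vec S(X): (A,B)^\triangleright\in\tau\}$. Tangles: an orientation of $\vec S_k(X)$ is a subset of $\vec S_k(X)$ containing exactly one of $(A,B)$ and $(B,A)$ for every $(A,B)\in\vec S_k(X)$. A tangle of $\vec S_k(X)$ is an orientation $\tau$ of $\vec S_k(X)$ such that there are no (not necessarily distinct) $(A_1,B_1),(A_2,B_2),(A_3,B_3)\in\tau$ with $A_1\cup A_2\cup A_3=X$. *)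

theory Defs
  imports Complex_Main
begin

text \<open>
  A simple bipartite graph is given by its partition classes and its edge set, edges being
  two-element vertex sets. Isolated vertices and empty classes are allowed.
\<close>

definition finite_bipartite_graph :: "'a set \<Rightarrow> 'a set \<Rightarrow> 'a set set \<Rightarrow> bool" where
  "finite_bipartite_graph X Y E \<longleftrightarrow>
     finite X \<and> finite Y \<and> X \<inter> Y = {} \<and> (\<forall>e\<in>E. \<exists>x\<in>X. \<exists>y\<in>Y. e = {x, y})"

definition neighbours :: "'a set set \<Rightarrow> 'a \<Rightarrow> 'a set" where
  "neighbours E v = {w. {v, w} \<in> E}"

definition separations :: "'a set \<Rightarrow> ('a set \<times> 'a set) set" where
  "separations Z = {(A, B). A \<subseteq> Z \<and> B \<subseteq> Z \<and> A \<union> B = Z}"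

text \<open>
  The constructions below are symmetric in the two partition classes. Throughout, \<open>Z\<close> is the
  class being separated and \<open>W\<close> is the opposite class: \<open>Z = X\<close>, \<open>W = Y\<close> or
  \<open>Z = Y\<close>, \<open>W = X\<close>.
\<close>

definition sep_order :: "'a set set \<Rightarrow> 'a set \<Rightarrow> 'a set \<times> 'a set \<Rightarrow> real" where
  "sep_order E W = (\<lambda>(A, B). \<Sum>w\<in>W.
     min (real (card (neighbours E w \<inter> A))) (real (card (neighbours E w \<inter> B)))
       - 1 / 2 * real (card (neighbours E w \<inter> A \<inter> B)))"

definition separations_below ::
  "'a set set \<Rightarrow> 'a set \<Rightarrow> 'a set \<Rightarrow> real \<Rightarrow> ('a set \<times> 'a set) set" where
  "separations_below E Z W k = {s \<in> separations Z. sep_order E W s < k}"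

text \<open>
  The shift of a separation of \<open>Z\<close> to the opposite class \<open>W\<close>: this is
  \<open>(A, B)\<close> with superscript right triangle for \<open>W = Y\<close> and left triangle for \<open>W = X\<close>.
\<close>

definition shift :: "'a set set \<Rightarrow> 'a set \<Rightarrow> 'a set \<times> 'a set \<Rightarrow> 'a set \<times> 'a set" where
  "shift E W = (\<lambda>(A, B).
     ({w \<in> W. card (neighbours E w \<inter> A) \<ge> card (neighbours E w \<inter> B)},
      {w \<in> W. card (neighbours E w \<inter> A) \<le> card (neighbours E w \<inter> B)}))"

text \<open>
  Pull-back of a set \<open>T\<close> of separations of \<open>W\<close> to a set of separations of \<open>Z\<close>.
\<close>

definition pull_back ::
  "'a set set \<Rightarrow> 'a set \<Rightarrow> 'a set \<Rightarrow> ('a set \<times> 'a set) set \<Rightarrow> ('a set \<times> 'a set) set" where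
  "pull_back E Z W T = {s \<in> separations Z. shift E W s \<in> T}"

text \<open>
  No orientation exists in this sense if \<open>(Z, Z) \<in> S\<close>; for the sets considered here this is
  excluded by \<open>admissible\<close>.
\<close>

definition orientation :: "('a set \<times> 'a set) set \<Rightarrow> ('a set \<times> 'a set) set \<Rightarrow> bool" where
  "orientation S T \<longleftrightarrow>
     T \<subseteq> S \<and> (\<forall>(A, B)\<in>S. (A, B) \<in> T \<longleftrightarrow> (B, A) \<notin> T)"

definition tangle ::
  "'a set set \<Rightarrow> 'a set \<Rightarrow> 'a set \<Rightarrow> real \<Rightarrow> ('a set \<times> 'a set) set \<Rightarrow> bool" where
  "tangle E Z W k T \<longleftrightarrow>
     orientation (separations_below E Z W k) T \<and>
     \<not> (\<exists>(A1, B1)\<in>T. \<exists>(A2, B2)\<in>T. \<exists>(A3, B3)\<in>T. A1 \<union> A2 \<union> A3 = Z)"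

text \<open>The standing assumption on \<open>k\<close> whenever \<open>separations_below E Z W k\<close> is considered.\<close>

definition admissible :: "'a set set \<Rightarrow> 'a set \<Rightarrow> 'a set \<Rightarrow> real \<Rightarrow> bool" where
  "admissible E Z W k \<longleftrightarrow> (Z, Z) \<notin> separations_below E Z W k"

end

theory Submission
  imports Defs
begin

text \<open>
  Let \<open>(A, B) \<in> \<tau>''\<close> shift to \<open>(C, D)\<close>, and \<open>(C, D)\<close> in turn to \<open>(A', B') \<in> \<tau>\<close>. The vertices
  outside \<open>A' \<union> B\<close> form the set \<open>Q\<close> of those \<open>x \<in> A - B\<close> with fewer neighbours in \<open>C\<close> than in
  \<open>D\<close>. Every edge between \<open>A - B\<close> and \<open>D\<close> contributes 1 to the order of \<open>(A, B)\<close>, and at least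
  half of the edges at \<open>Q\<close> go to \<open>D\<close>, so \<open>(Q, X)\<close> has order less than \<open>k\<close> and hence lies in
  \<open>\<tau>\<close>. If \<open>(A, B)\<close> were not in \<open>\<tau>\<close>, then \<open>(A', B')\<close>, \<open>(B, A)\<close> and \<open>(Q, X)\<close> would be three
  elements of \<open>\<tau>\<close> whose first sides cover \<open>X\<close>.
\<close>

text \<open>Double counting of the pairs in \<open>S \<times> T\<close> joined by \<open>E\<close>.
  It converts degree bounds at vertices of one class into sums over the other class, where orders
  are computed.\<close>

lemma sum_card_neighbours_swap:
  assumes "finite S" "finite T"
  shows "(\<Sum>v\<in>S. card (neighbours E v \<inter> T)) = (\<Sum>w\<in>T. card (neighbours E w \<inter> S))"
proof -
  have "(\<Sum>v\<in>S. card {w \<in> T. {v, w} \<in> E}) = (\<Sum>w\<in>T. card {v \<in> S. {v, w} \<in> E})"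
    by (rule sum_multicount_gen) (use assms in auto)
  moreover have "neighbours E v \<inter> T = {w \<in> T. {v, w} \<in> E}" for v
    by (auto simp: neighbours_def)
  moreover have "neighbours E w \<inter> S = {v \<in> S. {v, w} \<in> E}" for w
    by (auto simp: neighbours_def insert_commute)
  ultimately show ?thesis by simp
qed

lemma separations_below_mono:
  "k \<le> l \<Longrightarrow> separations_below E Z W k \<subseteq> separations_below E Z W l"
  by (auto simp: separations_below_def)

lemma tangle_swap_in:
  assumes "tangle E Z W k T" "(A, B) \<in> separations_below E Z W k" "(A, B) \<notin> T"
  shows "(B, A) \<in> T"
  using assms by (auto simp: tangle_def orientation_def)

lemma tangle_no_cover:
  assumes "tangle E Z W k T" "(A1, B1) \<in> T" "(A2, B2) \<in> T" "(A3, B3) \<in> T"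
  shows "A1 \<union> A2 \<union> A3 \<noteq> Z"
  using assms unfolding tangle_def by blast

text \<open>Otherwise \<open>(Z, Q)\<close> lies in \<open>T\<close>, and used three times it is a
  forbidden triple, since its first side alone is \<open>Z\<close>.\<close>

lemma tangle_with_whole_side:
  assumes "tangle E Z W k T" "(Q, Z) \<in> separations_below E Z W k"
  shows "(Q, Z) \<in> T"
proof (rule ccontr)
  assume "(Q, Z) \<notin> T"
  then have "(Z, Q) \<in> T"
    by (rule tangle_swap_in[OF assms])
  with tangle_no_cover[OF assms(1) this this this] show False
    by simp
qed

text \<open>As \<open>Q\<close> lies inside \<open>Z\<close>, both the minimum and the overlap equal
  the degree into \<open>Q\<close>, so each edge at \<open>Q\<close> counts one half.\<close>

lemma sep_order_with_whole_side:
  assumes "Q \<subseteq> Z" "finite Z"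
  shows "sep_order E W (Q, Z) = (\<Sum>w\<in>W. real (card (neighbours E w \<inter> Q))) / 2"
proof -
  have "min (real (card (neighbours E w \<inter> Q))) (real (card (neighbours E w \<inter> Z)))
      = real (card (neighbours E w \<inter> Q))" for w
    by (rule min_absorb1) (use assms in \<open>auto intro!: card_mono\<close>)
  moreover have "neighbours E w \<inter> Q \<inter> Z = neighbours E w \<inter> Q" for w
    using assms by blast
  ultimately show ?thesis
    by (simp add: sep_order_def sum_divide_distrib)
qed

text \<open>On the second side of the shift the minimum is attained at \<open>A\<close>. Splitting
  off the overlap leaves the neighbours in \<open>A - B\<close> plus half of the overlap. All other
  summands of the order are nonnegative.\<close>

lemma sum_card_neighbours_le_sep_order:
  assumes "finite W" "finite A" "finite B"
  shows "(\<Sum>w\<in>snd (shift E W (A, B)). real (card (neighbours E w \<inter> (A - B))))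
    \<le> sep_order E W (A, B)"
proof -
  let ?N = "neighbours E" and ?D = "snd (shift E W (A, B))"
  let ?t = "\<lambda>w. min (real (card (?N w \<inter> A))) (real (card (?N w \<inter> B)))
       - 1 / 2 * real (card (?N w \<inter> A \<inter> B))"
  have D: "?D = {w \<in> W. card (?N w \<inter> A) \<le> card (?N w \<inter> B)}"
    by (simp add: shift_def)
  have nonneg: "0 \<le> ?t w" for w
  proof -
    have "card (?N w \<inter> A \<inter> B) \<le> card (?N w \<inter> A)" "card (?N w \<inter> A \<inter> B) \<le> card (?N w \<inter> B)"
      using assms by (auto intro!: card_mono)
    then show ?thesis by (simp add: min_def)
  qed
  have le: "real (card (?N w \<inter> (A - B))) \<le> ?t w" if "w \<in> ?D" for w
  proof -
    have "card (?N w \<inter> A) = card ((?N w \<inter> (A - B)) \<union> (?N w \<inter> A \<inter> B))"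
      by (rule arg_cong[of _ _ card]) blast
    also have "\<dots> = card (?N w \<inter> (A - B)) + card (?N w \<inter> A \<inter> B)"
      by (rule card_Un_disjoint) (use assms in auto)
    finally show ?thesis
      using that by (simp add: D)
  qed
  have "(\<Sum>w\<in>?D. real (card (?N w \<inter> (A - B)))) \<le> (\<Sum>w\<in>?D. ?t w)"
    by (rule sum_mono) (rule le)
  also have "\<dots> \<le> (\<Sum>w\<in>W. ?t w)"
    by (rule sum_mono2) (use assms nonneg in \<open>auto simp: D\<close>)
  finally show ?thesis
    by (simp add: sep_order_def)
qed

text \<open>No constant is lost: the factor 2 from replacing \<open>Y\<close> by \<open>D\<close>
  cancels against the one half in the order of \<open>(Q, X)\<close>.\<close>

lemma sep_order_double_shift_remainder:
  assumes fin: "finite X" "finite Y" and sep: "(A, B) \<in> separations X"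
  shows "sep_order E Y (X - (fst (shift E X (shift E Y (A, B))) \<union> B), X) \<le> sep_order E Y (A, B)"
proof -
  let ?N = "neighbours E"
  obtain C D where CD: "shift E Y (A, B) = (C, D)" by fastforce
  define Q where "Q = X - (fst (shift E X (C, D)) \<union> B)"
  have fQ: "finite Q" and QAB: "Q \<subseteq> A - B" and finAB: "finite A" "finite B"
    using fin sep by (auto simp: Q_def separations_def)
  have Y: "Y = C \<union> D" and finCD: "finite C" "finite D"
    using CD fin by (auto simp: shift_def)
  \<comment> \<open>Missing the first side of the shift of \<open>(C, D)\<close> means having fewer
    neighbours in \<open>C\<close> than in \<open>D\<close>, and \<open>C\<close> and
    \<open>D\<close> together cover \<open>Y\<close>.\<close>
  have half: "card (?N x \<inter> Y) \<le> 2 * card (?N x \<inter> D)" if "x \<in> Q" for x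
  proof -
    have "card (?N x \<inter> Y) \<le> card (?N x \<inter> C) + card (?N x \<inter> D)"
      unfolding Y Int_Un_distrib by (rule card_Un_le)
    with that show ?thesis by (auto simp: Q_def shift_def)
  qed
  have "(\<Sum>y\<in>Y. card (?N y \<inter> Q)) = (\<Sum>x\<in>Q. card (?N x \<inter> Y))"
    by (rule sum_card_neighbours_swap) (use fin fQ in auto)
  also have "\<dots> \<le> (\<Sum>x\<in>Q. 2 * card (?N x \<inter> D))"
    by (rule sum_mono) (rule half)
  also have "\<dots> = 2 * (\<Sum>y\<in>D. card (?N y \<inter> Q))"
    by (simp add: sum_distrib_left[symmetric] sum_card_neighbours_swap[OF fQ finCD(2)])
  also have "\<dots> \<le> 2 * (\<Sum>y\<in>D. card (?N y \<inter> (A - B)))"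
    by (intro mult_left_mono sum_mono card_mono) (use QAB finAB in auto)
  finally have "real (\<Sum>y\<in>Y. card (?N y \<inter> Q)) \<le> real (2 * (\<Sum>y\<in>D. card (?N y \<inter> (A - B))))"
    by (rule of_nat_mono)
  moreover have "sep_order E Y (Q, X) = real (\<Sum>y\<in>Y. card (?N y \<inter> Q)) / 2"
    using sep_order_with_whole_side[of Q X E Y] fin by (simp add: Q_def)
  moreover have "real (\<Sum>y\<in>D. card (?N y \<inter> (A - B))) \<le> sep_order E Y (A, B)"
    using sum_card_neighbours_le_sep_order[OF fin(2) finAB, of E] by (simp add: CD)
  ultimately show ?thesis
    unfolding CD Q_def by linarith
qed

theorem theorem4p5:
  fixes X Y :: "'a set" and E :: "'a set set" and k :: real
    and \<tau> \<tau>' \<tau>'' :: "('a set \<times> 'a set) set"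
  assumes "finite_bipartite_graph X Y E"
    and "k > 0"
    and "admissible E X Y (16 * k)"
    and "admissible E Y X (4 * k)"
    and "admissible E X Y k"
    and "tangle E X Y (16 * k) \<tau>"
    and "\<tau>' = pull_back E Y X \<tau> \<inter> separations_below E Y X (4 * k)"
    and "\<tau>'' = pull_back E X Y \<tau>' \<inter> separations_below E X Y k"
  shows "\<tau>'' \<subseteq> \<tau>"
proof (rule subrelI, rule ccontr)
  fix A B
  assume AB: "(A, B) \<in> \<tau>''" and notin: "(A, B) \<notin> \<tau>"
  have fin: "finite X" "finite Y"
    using assms(1) by (auto simp: finite_bipartite_graph_def)
  have AB_k: "(A, B) \<in> separations_below E X Y k"
    using AB assms(8) by blast
  then have sep: "(A, B) \<in> separations X" and ord: "sep_order E Y (A, B) < k"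
    by (auto simp: separations_below_def)
  \<comment> \<open>Both \<open>(A, B)\<close> and the remainder have order below \<open>k\<close>,
    so the tangle of order \<open>16 * k\<close> orients them.\<close>
  have mono: "separations_below E X Y k \<subseteq> separations_below E X Y (16 * k)"
    by (rule separations_below_mono) (use assms(2) in simp)
  obtain A' B' where A'B': "shift E X (shift E Y (A, B)) = (A', B')" by fastforce
  have 1: "(A', B') \<in> \<tau>"
    using AB A'B' assms(7,8) by (auto simp: pull_back_def)
  have 2: "(B, A) \<in> \<tau>"
    using tangle_swap_in[OF assms(6)] AB_k mono notin by blast
  have "sep_order E Y (X - (A' \<union> B), X) < k"
    using sep_order_double_shift_remainder[OF fin sep, of E] ord by (simp add: A'B')
  then have "(X - (A' \<union> B), X) \<in> separations_below E X Y k"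
    by (auto simp: separations_below_def separations_def)
  then have 3: "(X - (A' \<union> B), X) \<in> \<tau>"
    using tangle_with_whole_side[OF assms(6)] mono by blast
  have "A' \<subseteq> X"
    using A'B' by (auto simp: shift_def split: prod.splits)
  then have "A' \<union> B \<union> (X - (A' \<union> B)) = X"
    using sep by (auto simp: separations_def)
  with tangle_no_cover[OF assms(6) 1 2 3] show False by blast
qed

end
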